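(* For every integer $k \geq 4$, the complement $\overline{C_{2k}}$ of the cycle on $2k$ vertices is a minimal non-UDG; that is, it is not a unit disk graph, but every proper induced subgraph of it is a unit disk graph.
   Context: All graphs are finite and simple. A graph $G=(V,E)$ is a unit disk graph (UDG) if there is a function $f:V\to\mathbb{R}^2$ such that for distinct $u,v\in V$, $uv\in E$ if and only if the Euclidean distance between $f(u)$ and $f(v)$ is at most $1$. $C_n$ is the chordless cycle on $n$ vertices and $\overline{G}$ denotes the complement of $G$. *)

theory Defs
  imports
    "HOL-Analysis.Analysis"
    "Graph_Theory.Pair_Digraph"
    "Graph_Theory.Digraph_Component"
begin

text \<open>
  A finite simple graph is a \<open>pair_graph\<close>: a finite, loop-free, symmetric digraph whose arcs
  are pairs of vertices, so that an edge \<open>uv\<close> is represented by the two arcs \<open>(u,v)\<close> and \<open>(v,u)\<close>.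
\<close>

definition unit_disk_graph :: "'a pair_pre_digraph \<Rightarrow> bool" where
  "unit_disk_graph G \<longleftrightarrow>
     pair_graph G \<and>
     (\<exists>f :: 'a \<Rightarrow> real ^ 2.
        \<forall>u \<in> pverts G. \<forall>v \<in> pverts G.
          u \<noteq> v \<longrightarrow> ((u, v) \<in> parcs G \<longleftrightarrow> dist (f u) (f v) \<le> 1))"

text \<open>The graph without vertices counts as an induced subgraph; it is trivially a unit disk graph.\<close>

definition minimal_non_udg :: "'a pair_pre_digraph \<Rightarrow> bool" where
  "minimal_non_udg G \<longleftrightarrow>
     pair_graph G \<and>
     \<not> unit_disk_graph G \<and>
     (\<forall>H :: 'a pair_pre_digraph.
        induced_subgraph (with_proj H) (with_proj G) \<and> pverts H \<noteq> pverts G \<longrightarrow>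
        unit_disk_graph H)"

definition complement_graph :: "'a pair_pre_digraph \<Rightarrow> 'a pair_pre_digraph" where
  "complement_graph G =
     \<lparr> pverts = pverts G,
       parcs = {(u, v). u \<in> pverts G \<and> v \<in> pverts G \<and> u \<noteq> v \<and> (u, v) \<notin> parcs G} \<rparr>"

text \<open>Meaningful as a simple graph only for \<open>n \<ge> 3\<close> (for \<open>n = 1\<close> there would be a loop).\<close>

definition cycle_graph :: "nat \<Rightarrow> nat pair_pre_digraph" where
  "cycle_graph n =
     \<lparr> pverts = {0..<n},
       parcs = {(u, v). u < n \<and> v < n \<and> (v = Suc u mod n \<or> u = Suc v mod n)} \<rparr>"

lemma pair_graph_cycle_graph:
  assumes "n \<ge> 3"
  shows "pair_graph (cycle_graph n)"
proof
  show "finite (parcs (cycle_graph n))"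
    by (rule finite_subset[of _ "{0..<n} \<times> {0..<n}"]) (auto simp: cycle_graph_def)
  show "fst e \<noteq> snd e" if "e \<in> parcs (cycle_graph n)" for e
    using that assms by (auto simp: cycle_graph_def mod_Suc split: if_splits)
qed (auto simp: cycle_graph_def symmetric_def sym_def)

lemma pair_graph_complement_graph:
  assumes "pair_graph G"
  shows "pair_graph (complement_graph G)"
proof -
  interpret pair_graph G by fact
  have sym: "(v, u) \<in> parcs G \<longleftrightarrow> (u, v) \<in> parcs G" for u v
    using pair_sym_arcs by (auto simp: symmetric_def sym_def)
  show ?thesis
  proof
    show "finite (parcs (complement_graph G))"
      by (rule finite_subset[of _ "pverts G \<times> pverts G"])
        (auto simp: complement_graph_def pair_finite_verts)
  qed (auto simp: complement_graph_def symmetric_def sym_def sym pair_finite_verts)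
qed

end

theory Submission
  imports Defs
begin

text \<open>
  If \<open>p\<^sub>0, p\<^sub>1, \<dots>\<close> represents the complement of an even cycle, two long segments
  \<open>p\<^sub>i p\<^sub>i\<^sub>+\<^sub>1\<close> and \<open>p\<^sub>j p\<^sub>j\<^sub>+\<^sub>1\<close> at cyclic distance at least 3 cross each other. Hence, along
  the admissible \<open>j\<close>, the vertices alternate sides of the line through segment \<open>i\<close>, so the sign
  of \<open>(-1)\<^sup>i\<^sup>+\<^sup>j det (p\<^sub>i\<^sub>+\<^sub>1 - p\<^sub>i) (p\<^sub>j\<^sub>+\<^sub>1 - p\<^sub>j)\<close> is a sign \<open>\<tau>\<^sub>i\<close> depending on \<open>i\<close> only; parity of the cycle
  makes this consistent around the cycle. Antisymmetry gives \<open>\<tau>\<^sub>j = -\<tau>\<^sub>i\<close> whenever \<open>i\<close> and \<open>j\<close> are at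
  distance at least 3. For length at least 8, \<open>i\<close> and \<open>i + 1\<close> are both opposite to \<open>i + 4\<close>, so
  all \<open>\<tau>\<^sub>i\<close> agree, a contradiction.

  The complement of a path is realised by consecutive points of a star polygon: rotation by slightly
  more than a half turn on a circle of diameter slightly above 1.
\<close>

text \<open>
  Here \<open>N = |ac|\<^sup>2\<close>, and \<open>(x, y)\<close>, \<open>(z, w)\<close> are points of the lens of unit disks around \<open>a\<close> and \<open>c\<close>,
  in coordinates with axis \<open>ac\<close> and origin \<open>a\<close>, scaled by \<open>|ac|\<close>.
\<close>

lemma half_lens_diameter:
  fixes N x y z w :: real
  assumes "N > 1" "x\<^sup>2 + y\<^sup>2 \<le> N" "(N - x)\<^sup>2 + y\<^sup>2 \<le> N"
    and "z\<^sup>2 + w\<^sup>2 \<le> N" "(N - z)\<^sup>2 + w\<^sup>2 \<le> N" "y * w \<ge> 0"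
  shows "(x - z)\<^sup>2 + (y - w)\<^sup>2 \<le> N"
proof -
  \<comment> \<open>Exchanging the points allows \<open>\<bar>w\<bar> \<le> \<bar>y\<bar>\<close>.
    Moving \<open>(z, w)\<close> to one of \<open>a\<close>, \<open>c\<close> then brings it no
    closer to \<open>(x, y)\<close> in either coordinate.\<close>
  have aux: "(x - z)\<^sup>2 + (y - w)\<^sup>2 \<le> N"
    if "x\<^sup>2 + y\<^sup>2 \<le> N" "(N - x)\<^sup>2 + y\<^sup>2 \<le> N" "z\<^sup>2 + w\<^sup>2 \<le> N" "(N - z)\<^sup>2 + w\<^sup>2 \<le> N"
      "y * w \<ge> 0" "\<bar>w\<bar> \<le> \<bar>y\<bar>" for x y z w
  proof -
    have "N < N\<^sup>2"
      using \<open>N > 1\<close> by (simp add: power2_eq_square)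
    have "z\<^sup>2 < N\<^sup>2" "(N - z)\<^sup>2 < N\<^sup>2"
      using that \<open>N < N\<^sup>2\<close> zero_le_power2[of w] by linarith+
    then have z: "0 < z" "z < N"
      using power2_less_imp_less[of z N] power2_less_imp_less[of "N - z" N] \<open>N > 1\<close> by auto
    have "\<bar>y - w\<bar> \<le> \<bar>y\<bar>"
      using that by (auto simp: abs_if zero_le_mult_iff split: if_splits)
    then have "(y - w)\<^sup>2 \<le> y\<^sup>2"
      by (simp add: abs_le_square_iff)
    moreover have "(x - z)\<^sup>2 \<le> x\<^sup>2 \<or> (x - z)\<^sup>2 \<le> (N - x)\<^sup>2"
      using z by (cases "z \<le> x") (auto simp flip: abs_le_square_iff)
    ultimately show ?thesis
      using that by linarith
  qed
  show ?thesis
    using aux[of x y z w] aux[of z w x y] assms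
    by (cases "\<bar>w\<bar> \<le> \<bar>y\<bar>") (auto simp: mult.commute power2_commute)
qed

definition det2 :: "real ^ 2 \<Rightarrow> real ^ 2 \<Rightarrow> real" where
  "det2 u v = u $ 1 * v $ 2 - u $ 2 * v $ 1"

lemma norm_vec2_sq: "(norm (u :: real ^ 2))\<^sup>2 = (u $ 1)\<^sup>2 + (u $ 2)\<^sup>2"
  by (simp add: norm_vec_def L2_set_def sum_2)

text \<open>Lagrange's identity in the plane: \<open>u \<bullet> v\<close> and
  \<open>det2 u v\<close> are the coordinates of \<open>v\<close> along and across \<open>u\<close>,
  scaled by \<open>norm u\<close>.\<close>

lemma inner_det2_sq: "(u \<bullet> v)\<^sup>2 + (det2 u v)\<^sup>2 = (norm u)\<^sup>2 * (norm v)\<^sup>2"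
  unfolding norm_vec2_sq by (simp add: inner_vec_def sum_2 det2_def power2_eq_square algebra_simps)

text \<open>Otherwise \<open>b\<close> and \<open>d\<close> share a closed half of the lens of unit
  disks around \<open>a\<close> and \<open>c\<close>. Such a half has diameter at most 1, against
  \<open>dist b d > 1\<close>.\<close>

lemma diagonals_separate:
  fixes a b c d :: "real ^ 2"
  assumes "dist a c > 1" "dist b d > 1" "dist a b \<le> 1" "dist b c \<le> 1" "dist c d \<le> 1" "dist d a \<le> 1"
  shows "det2 (c - a) (b - a) * det2 (c - a) (d - a) < 0"
proof (rule ccontr)
  assume same_side: "\<not> ?thesis"
  define N where "N = (norm (c - a))\<^sup>2"
  have "N > 1"
    using assms(1) unfolding N_def by (simp add: dist_norm norm_minus_commute)
  have lens: "((c - a) \<bullet> (q - a))\<^sup>2 + (det2 (c - a) (q - a))\<^sup>2 \<le> N"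
      "(N - (c - a) \<bullet> (q - a))\<^sup>2 + (det2 (c - a) (q - a))\<^sup>2 \<le> N"
    if "dist q a \<le> 1" "dist q c \<le> 1" for q
  proof -
    have "(norm (q - a))\<^sup>2 \<le> 1" "(norm (q - c))\<^sup>2 \<le> 1"
      using that by (simp_all add: dist_norm power_le_one)
    then have "N * (norm (q - a))\<^sup>2 \<le> N" "N * (norm (q - c))\<^sup>2 \<le> N"
      using \<open>N > 1\<close> by (simp_all add: mult_le_cancel_left1)
    moreover have "N - (c - a) \<bullet> (q - a) = - ((c - a) \<bullet> (q - c))"
      "det2 (c - a) (q - a) = det2 (c - a) (q - c)"
      unfolding N_def by (simp_all add: power2_norm_eq_inner inner_diff inner_commute det2_def algebra_simps)
    ultimately show "((c - a) \<bullet> (q - a))\<^sup>2 + (det2 (c - a) (q - a))\<^sup>2 \<le> N"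
      "(N - (c - a) \<bullet> (q - a))\<^sup>2 + (det2 (c - a) (q - a))\<^sup>2 \<le> N"
      using inner_det2_sq[of "c - a" "q - a"] inner_det2_sq[of "c - a" "q - c"]
      by (simp_all add: N_def)
  qed
  have "((c - a) \<bullet> (b - a) - (c - a) \<bullet> (d - a))\<^sup>2 + (det2 (c - a) (b - a) - det2 (c - a) (d - a))\<^sup>2 \<le> N"
    using assms same_side \<open>N > 1\<close>
    by (intro half_lens_diameter lens) (auto simp: dist_commute)
  also have "(c - a) \<bullet> (b - a) - (c - a) \<bullet> (d - a) = (c - a) \<bullet> (b - d)"
    by (simp add: inner_diff)
  also have "det2 (c - a) (b - a) - det2 (c - a) (d - a) = det2 (c - a) (b - d)"
    by (simp add: det2_def algebra_simps)
  finally have "N * (norm (b - d))\<^sup>2 \<le> N"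
    by (simp add: inner_det2_sq N_def)
  then have "(norm (b - d))\<^sup>2 \<le> 1"
    using \<open>N > 1\<close> by (simp add: mult_le_cancel_left1)
  moreover have "(norm (b - d))\<^sup>2 > 1"
    using assms(2) by (simp add: dist_norm)
  ultimately show False by simp
qed

lemma no_even_cycle_complement:
  fixes p :: "nat \<Rightarrow> real ^ 2"
  assumes "even n" "n \<ge> 8"
    and periodic: "\<And>i. p (i + n) = p i"
    and far: "\<And>i. dist (p i) (p (Suc i)) > 1"
    and near: "\<And>i j. i + 2 \<le> j \<Longrightarrow> j + 2 \<le> i + n \<Longrightarrow> dist (p i) (p j) \<le> 1"
  shows False
proof -
  define d where "d i = p (Suc i) - p i" for i
  define E where "E i j = (- 1) ^ (i + j) * det2 (d i) (d j)" for i j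
  \<comment> \<open>Parity enters here: shifting an index by the even \<open>n\<close> preserves the
    alternating factor.\<close>
  have E_swap: "E j (i + n) = - E i j" for i j
    using \<open>even n\<close> periodic[of i] periodic[of "Suc i"]
    by (simp add: E_def d_def det2_def power_add algebra_simps)
  \<comment> \<open>Segments \<open>i\<close> and \<open>j\<close> are the diagonals of a
    quadrilateral whose four sides are short thanks to the margin 3.\<close>
  have cross: "E i j * ((- 1) ^ (i + j) * det2 (d i) (p (Suc j) - p i)) > 0"
      "E i j * ((- 1) ^ (i + j) * det2 (d i) (p j - p i)) < 0"
    if "i + 3 \<le> j" "j + 3 \<le> i + n" for i j
  proof -
    let ?s = "det2 (d i) (p j - p i)" and ?t = "det2 (d i) (p (Suc j) - p i)"
    have "?s * ?t < 0"
      unfolding d_def using that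
      by (intro diagonals_separate far) (auto intro!: near simp: dist_commute[of _ "p i"] dist_commute[of _ "p (Suc i)"])
    moreover have "det2 (d i) (d j) = ?t - ?s"
      by (simp add: d_def det2_def algebra_simps)
    moreover have "(?t - ?s) * ?t > 0 \<and> (?t - ?s) * ?s < 0" if "?s * ?t < 0"
      using that by (auto simp: mult_less_0_iff zero_less_mult_iff)
    moreover have "E i j * ((- 1) ^ (i + j) * x) = det2 (d i) (d j) * x" for x
      by (simp add: E_def)
    ultimately show "E i j * ((- 1) ^ (i + j) * ?t) > 0" "E i j * ((- 1) ^ (i + j) * ?s) < 0"
      by metis+
  qed
  \<comment> \<open>\<open>p (Suc j)\<close> ends segment \<open>j\<close> and starts segment
    \<open>Suc j\<close>; this change of role cancels the change of the alternating factor.\<close>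
  have same_sign: "E i j * E i (Suc j) > 0" if "i + 3 \<le> j" "Suc j + 3 \<le> i + n" for i j
    using cross(1)[of i j] cross(2)[of i "Suc j"] that
    by (auto simp: mult_less_0_iff zero_less_mult_iff)
  define \<tau> where "\<tau> i = E i (i + 3)" for i
  have \<tau>: "\<tau> i * E i j > 0" if "i + 3 \<le> j" "j + 3 \<le> i + n" for i j
    using that
  proof (induction j rule: dec_induct)
    case base
    show ?case
      using cross(1)[of i "i + 3"] base
      unfolding \<tau>_def by (metis le_refl less_numeral_extra(3) mult_zero_left not_real_square_gt_zero)
  next
    case (step j)
    then show ?case
      using same_sign[of i j]
      by (auto simp: zero_less_mult_iff)
  qed
  \<comment> \<open>\<open>\<tau> j\<close> has the sign of \<open>E j (i + n)\<close>, which is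
    \<open>- E i j\<close>.\<close>
  have opp: "\<tau> i * \<tau> j < 0" if "i + 3 \<le> j" "j + 3 \<le> i + n" for i j
    using \<tau>[of i j] \<tau>[of j "i + n"] that E_swap[of j i]
    by (auto simp: zero_less_mult_iff mult_less_0_iff)
  show False
    \<comment> \<open>The seven pairs form the odd cycle 0, 4, 1, 5, 2, 6, 3, along which signs
      cannot alternate.\<close>
    using opp[of 0 4] opp[of 1 4] opp[of 1 5] opp[of 2 5] opp[of 2 6] opp[of 3 6] opp[of 0 3] \<open>n \<ge> 8\<close>
    by (auto simp: mult_less_0_iff)
qed

lemma path_complement_realisation:
  fixes n :: nat
  obtains q :: "nat \<Rightarrow> real ^ 2"
  where "\<And>i j. i < j \<Longrightarrow> j < n \<Longrightarrow> dist (q i) (q j) \<le> 1 \<longleftrightarrow> j \<noteq> Suc i"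
proof -
  \<comment> \<open>The 3 ensures \<open>(m + 2) * \<phi> \<le> pi\<close> for \<open>m < n\<close>,
    and \<open>2 * \<phi> < pi\<close> even for \<open>n = 0\<close>.\<close>
  define \<phi> where "\<phi> = pi / (n + 3)"
  define \<psi> where "\<psi> = pi + \<phi>"
  \<comment> \<open>Unit chords subtend the angle \<open>pi - 2 * \<phi>\<close>. An odd step
    \<open>m\<close> subtends \<open>pi - m * \<phi>\<close>, so only \<open>m = 1\<close> is too
    long; an even step subtends \<open>m * \<phi>\<close>, which never exceeds the bound.\<close>
  define r where "r = sqrt (1 / (2 * (1 + cos (2 * \<phi>))))"
  define q :: "nat \<Rightarrow> real ^ 2" where "q i = vector [r * cos (i * \<psi>), r * sin (i * \<psi>)]" for i
  have \<phi>: "0 < \<phi>" "real (n + 3) * \<phi> = pi"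
    by (simp_all add: \<phi>_def)
  have bound: "real m * \<phi> \<le> pi" if "m \<le> n + 3" for m
    using that \<phi> mult_right_mono[of "real m" "real (n + 3)" \<phi>] by simp
  have "cos pi < cos (2 * \<phi>)"
    using bound[of 3] \<phi>(1) by (intro cos_monotone_0_pi) auto
  then have pos: "1 + cos (2 * \<phi>) > 0"
    by simp
  then have r: "r\<^sup>2 * (2 * (1 + cos (2 * \<phi>))) = 1"
    by (simp add: r_def)
  show thesis
  proof (rule that)
    fix i j :: nat
    assume ij: "i < j" "j < n"
    define m where "m = j - i"
    have j: "j = i + m" and m: "0 < m" "m < n"
      using ij by (auto simp: m_def)
    have "(dist (q i) (q j))\<^sup>2 = r\<^sup>2 * (2 * (1 - cos (real j * \<psi> - real i * \<psi>)))"
    proof -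
      have "(dist (q i) (q j))\<^sup>2 = r\<^sup>2 * (((cos (i * \<psi>))\<^sup>2 + (sin (i * \<psi>))\<^sup>2) + ((cos (j * \<psi>))\<^sup>2 + (sin (j * \<psi>))\<^sup>2)
          - 2 * cos (real j * \<psi> - real i * \<psi>))"
        unfolding dist_norm norm_vec2_sq cos_diff
        by (simp add: q_def power2_eq_square algebra_simps del: sin_cos_squared_add sin_cos_squared_add2 sin_cos_squared_add3)
      then show ?thesis by simp
    qed
    also have "real j * \<psi> - real i * \<psi> = real m * pi + real m * \<phi>"
      by (simp add: j \<psi>_def algebra_simps)
    also have "cos \<dots> = (- 1) ^ m * cos (real m * \<phi>)"
      by (simp add: cos_add cos_npi sin_npi)
    finally have "(dist (q i) (q j))\<^sup>2 \<le> 1 \<longleftrightarrow>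
        r\<^sup>2 * (2 * (1 - (- 1) ^ m * cos (real m * \<phi>))) \<le> r\<^sup>2 * (2 * (1 + cos (2 * \<phi>)))"
      using r by simp
    also have "\<dots> \<longleftrightarrow> - ((- 1) ^ m * cos (real m * \<phi>)) \<le> cos (2 * \<phi>)"
      using r by (subst mult_le_cancel_left_pos) (auto simp: zero_less_power2)
    also have "\<dots> \<longleftrightarrow> m \<noteq> 1"
    proof (cases "even m")
      case True
      have "cos (pi - 2 * \<phi>) \<le> cos (real m * \<phi>)"
        using bound[of "m + 2"] bound[of m] bound[of 2] m \<phi>(1)
        by (intro cos_monotone_0_pi_le) (auto simp: algebra_simps)
      then show ?thesis
        using True by (auto simp: cos_diff)
    next
      case False
      have "cos (real m * \<phi>) \<le> cos (2 * \<phi>) \<longleftrightarrow> 2 * \<phi> \<le> real m * \<phi>"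
        using bound[of 2] bound[of m] m \<phi>(1) by (intro cos_mono_le_eq) auto
      then show ?thesis
        using False \<phi>(1) m by auto
    qed
    also have "(dist (q i) (q j))\<^sup>2 \<le> 1 \<longleftrightarrow> dist (q i) (q j) \<le> 1"
      by (simp add: abs_square_le_1)
    finally show "dist (q i) (q j) \<le> 1 \<longleftrightarrow> j \<noteq> Suc i"
      by (simp add: j)
  qed
qed

lemma unit_disk_graph_induced_cycle_complement:
  fixes H :: "nat pair_pre_digraph"
  assumes "n \<ge> 3"
    and ind: "induced_subgraph (with_proj H) (with_proj (complement_graph (cycle_graph n)))"
    and ne: "pverts H \<noteq> pverts (complement_graph (cycle_graph n))"
  shows "unit_disk_graph H"
proof -
  have sub: "pverts H \<subseteq> {0..<n}"
    using ind by (auto simp: induced_subgraph_def subgraph_def complement_graph_def cycle_graph_def)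
  have arcs: "(u, v) \<in> parcs H \<longleftrightarrow>
      u \<in> pverts H \<and> v \<in> pverts H \<and> u \<noteq> v \<and> v \<noteq> Suc u mod n \<and> u \<noteq> Suc v mod n" for u v
    using ind sub by (auto simp: induced_subgraph_def subgraph_def complement_graph_def cycle_graph_def)
  obtain m where m: "m < n" "m \<notin> pverts H"
    using sub ne by (fastforce simp: complement_graph_def cycle_graph_def)
  have "pair_graph H"
  proof
    show "finite (pverts H)"
      using sub finite_subset by blast
    show "finite (parcs H)"
      by (rule finite_subset[of _ "pverts H \<times> pverts H"]) (use arcs \<open>finite (pverts H)\<close> in auto)
  qed (use arcs in \<open>auto simp: symmetric_def sym_def\<close>)
  obtain q :: "nat \<Rightarrow> real ^ 2"
    where q: "\<And>i j. i < j \<Longrightarrow> j < n \<Longrightarrow> dist (q i) (q j) \<le> 1 \<longleftrightarrow> j \<noteq> Suc i"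
    using path_complement_realisation[of n] by blast
  \<comment> \<open>The missing vertex \<open>m\<close> cuts the cycle into a path;
    \<open>pos v\<close> is \<open>v - m - 1\<close> modulo \<open>n\<close>, counting along it from
    \<open>m + 1\<close>.\<close>
  define pos where "pos v = (if v < m then v + n - Suc m else v - Suc m)" for v
  have "(u, v) \<in> parcs H \<longleftrightarrow> dist (q (pos u)) (q (pos v)) \<le> 1"
    if uv: "u \<in> pverts H" "v \<in> pverts H" "u \<noteq> v" for u v
  proof -
    have lt: "u < n" "v < n" "u \<noteq> m" "v \<noteq> m"
      using uv sub m by auto
    have succ: "y = Suc x mod n \<longleftrightarrow> pos y = Suc (pos x)"
      if "x < n" "y < n" "x \<noteq> m" "y \<noteq> m" for x y
      using that m by (auto simp: pos_def mod_Suc)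
    have "pos u < n" "pos v < n" "pos u \<noteq> pos v"
      using lt m uv(3) by (auto simp: pos_def)
    then have "dist (q (pos u)) (q (pos v)) \<le> 1 \<longleftrightarrow> pos v \<noteq> Suc (pos u) \<and> pos u \<noteq> Suc (pos v)"
      using q[of "pos u" "pos v"] q[of "pos v" "pos u"] by (auto simp: dist_commute nat_neq_iff)
    then show ?thesis
      using arcs uv lt succ by auto
  qed
  then show ?thesis
    unfolding unit_disk_graph_def using \<open>pair_graph H\<close> by (intro conjI exI[of _ "\<lambda>v. q (pos v)"]) auto
qed

lemma not_unit_disk_graph_even_cycle_complement:
  assumes "even n" "n \<ge> 8"
  shows "\<not> unit_disk_graph (complement_graph (cycle_graph n))"
proof
  assume "unit_disk_graph (complement_graph (cycle_graph n))"
  then obtain f :: "nat \<Rightarrow> real ^ 2" where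
    f: "\<And>u v. u < n \<Longrightarrow> v < n \<Longrightarrow> u \<noteq> v \<Longrightarrow>
      dist (f u) (f v) \<le> 1 \<longleftrightarrow> v \<noteq> Suc u mod n \<and> u \<noteq> Suc v mod n"
    by (fastforce simp: unit_disk_graph_def complement_graph_def cycle_graph_def)
  have f': "dist (f (i mod n)) (f (j mod n)) \<le> 1 \<longleftrightarrow> j mod n \<noteq> Suc i mod n \<and> i mod n \<noteq> Suc j mod n"
    if "i mod n \<noteq> j mod n" for i j
    using f[of "i mod n" "j mod n"] that assms by (simp add: mod_Suc_eq)
  have distinct: "i mod n \<noteq> j mod n" if "i < j" "j < i + n" for i j
    using that mod_eq_dvd_iff_nat[of i j n] nat_dvd_not_less[of "j - i" n] by (auto dest: sym)
  show False
  proof (rule no_even_cycle_complement[OF assms, of "\<lambda>i. f (i mod n)"])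
    show "dist (f (i mod n)) (f (Suc i mod n)) > 1" for i
      using f'[of i "Suc i"] distinct[of i "Suc i"] assms by auto
    show "dist (f (i mod n)) (f (j mod n)) \<le> 1" if "i + 2 \<le> j" "j + 2 \<le> i + n" for i j
    proof -
      have "i mod n \<noteq> j mod n" "Suc i mod n \<noteq> j mod n" "Suc j mod n \<noteq> i mod n"
        using distinct[of i j] distinct[of "Suc i" j] distinct[of i "Suc j"] that assms by auto
      then show ?thesis
        using f'[of i j] by simp
    qed
  qed simp
qed

theorem theorem7:
  fixes k :: nat
  assumes "k \<ge> 4"
  shows "minimal_non_udg (complement_graph (cycle_graph (2 * k)))"
  unfolding minimal_non_udg_def
  using assms pair_graph_complement_graph[OF pair_graph_cycle_graph[of "2 * k"]]
    not_unit_disk_graph_even_cycle_complement[of "2 * k"]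
    unit_disk_graph_induced_cycle_complement[of "2 * k"]
  by auto

end
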